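(* Let $n\geq 1$ and let $R\cong F_1\times F_2\times\cdots\times F_n$, where $F_1,\dots,F_n$ are finite fields. Then $\Gamma'_{Reg}(R)$ is a nontrivial connected graph if and only if $n\geq 2$.
   Context: All rings have an identity. A ring $R$ is von Neumann regular if for every $x\in R$ there is $y\in R$ with $xyx=x$ (finite products of fields are such rings). For such $R$, $\Gamma'_{Reg}(R)$ is the simple graph with vertex set $R\setminus\{0_R\}$ in which two distinct vertices $a,b$ are adjacent if and only if $aba=a$ or $bab=b$. A graph is nontrivial if it has at least two vertices. *)

theory Defs
  imports "HOL-Algebra.Algebra" "Graph_Theory.Graph_Theory"
begin

text \<open>
  Simple graphs are represented as symmetric loop-free digraphs without parallel arcs;
  an edge between \<open>a\<close> and \<open>b\<close> is the pair of arcs \<open>(a, b)\<close>, \<open>(b, a)\<close>.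
\<close>

definition reg_graph :: "('a, 'm) ring_scheme \<Rightarrow> 'a pair_pre_digraph" where
  "reg_graph R = \<lparr>
     pverts = carrier R - {\<zero>\<^bsub>R\<^esub>},
     parcs = {(a, b). a \<in> carrier R - {\<zero>\<^bsub>R\<^esub>} \<and> b \<in> carrier R - {\<zero>\<^bsub>R\<^esub>} \<and> a \<noteq> b \<and>
       (a \<otimes>\<^bsub>R\<^esub> b \<otimes>\<^bsub>R\<^esub> a = a \<or> b \<otimes>\<^bsub>R\<^esub> a \<otimes>\<^bsub>R\<^esub> b = b)} \<rparr>"

lemma reg_graph_simple: "pair_bidirected_digraph (reg_graph R)"
  by unfold_locales (auto simp: reg_graph_def symmetric_def sym_def)

definition nontrivial_graph :: "('a, 'b) pre_digraph \<Rightarrow> bool" where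
  "nontrivial_graph G \<longleftrightarrow> (\<exists>u\<in>verts G. \<exists>v\<in>verts G. u \<noteq> v)"

end

theory Submission
  imports Defs
begin

text \<open>
  A finite product of fields is a commutative von Neumann regular ring \<open>R\<close>, and for \<open>n \<ge> 2\<close> it has
  an idempotent \<open>e \<noteq> 0, 1\<close>; these two facts already give connectedness, by joining every vertex to \<open>1\<close>.
  Let \<open>a \<noteq> 0\<close> have quasi-inverse \<open>b\<close> (\<open>a b a = a\<close>, \<open>b a b = b\<close>) and put \<open>f = a b\<close>.
  If \<open>f \<noteq> 1\<close>, then \<open>a\<close>, \<open>b + (1 - f)\<close>, \<open>1 - f\<close>, \<open>1\<close> is a path. If \<open>f = 1\<close>, then \<open>a\<close> is
  adjacent to the nonzero non-unit \<open>b e\<close>, to which the first case applies.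
  For \<open>n = 1\<close> two elements \<open>a \<noteq> b\<close> of the field are adjacent iff \<open>a b = 1\<close>, so \<open>1\<close> is isolated.
\<close>

section \<open>Von Neumann regularity of fields\<close>

definition vn_regular :: "('a, 'm) ring_scheme \<Rightarrow> bool" where
  "vn_regular R \<longleftrightarrow> (\<forall>x\<in>carrier R. \<exists>y\<in>carrier R. x \<otimes>\<^bsub>R\<^esub> y \<otimes>\<^bsub>R\<^esub> x = x)"

lemma (in field) field_vn_regular: "vn_regular R"
  unfolding vn_regular_def
proof
  fix x assume x: "x \<in> carrier R"
  show "\<exists>y\<in>carrier R. x \<otimes> y \<otimes> x = x"
  proof (cases "x = \<zero>")
    case True
    then show ?thesis using x by (intro bexI[of _ x]) simp_all
  next
    case False
    then have "x \<in> Units R"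
      using x field_Units by simp
    then show ?thesis
      using x by (intro bexI[of _ "inv x"]) simp_all
  qed
qed

section \<open>Finite direct products\<close>

text \<open>Consing \<open>(x, xs)\<close> to \<open>x # xs\<close> is a ring homomorphism from the
  binary product, whose multiplication is componentwise. This is what lets inductions over the list
  of factors compute products.\<close>

lemma RDirProd_list_mult_Cons:
  assumes "x \<in> carrier R" "xs \<in> carrier (RDirProd_list Rs)"
    and "y \<in> carrier R" "ys \<in> carrier (RDirProd_list Rs)"
  shows "(x # xs) \<otimes>\<^bsub>RDirProd_list (R # Rs)\<^esub> (y # ys)
    = (x \<otimes>\<^bsub>R\<^esub> y) # (xs \<otimes>\<^bsub>RDirProd_list Rs\<^esub> ys)"
  using ring_hom_memE(2)[OF RDirProd_list_hom1[of R Rs], of "(x, xs)" "(y, ys)"] assms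
  by (simp add: RDirProd_def DirProd_def monoid.defs)

lemma RDirProd_list_one_Cons:
  "\<one>\<^bsub>RDirProd_list (R # Rs)\<^esub> = \<one>\<^bsub>R\<^esub> # \<one>\<^bsub>RDirProd_list Rs\<^esub>"
  by (simp add: RDirProd_list_one)

lemma RDirProd_list_cring:
  assumes "\<And>F. F \<in> set Fs \<Longrightarrow> cring F"
  shows "cring (RDirProd_list Fs)"
  using assms
proof (induction Fs)
  case Nil
  have "ring (RDirProd_list [])"
    by (rule RDirProd_list_is_ring) simp
  then interpret ring "RDirProd_list []" .
  show ?case by unfold_locales (simp add: monoid.defs)
next
  case (Cons F Fs)
  then interpret F: cring F by simp
  interpret S: cring "RDirProd_list Fs" using Cons by simp
  have "ring (RDirProd_list (F # Fs))"
    by (intro RDirProd_list_is_ring cring.axioms(1) Cons.prems nth_mem)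
  then interpret ring "RDirProd_list (F # Fs)" .
  show ?case
    by unfold_locales
      (auto simp: RDirProd_list_carrier RDirProd_list_mult_Cons F.m_comm S.m_comm)
qed

text \<open>An inner inverse can be chosen in each coordinate separately; the empty product is the
  zero ring.\<close>

lemma RDirProd_list_vn_regular:
  assumes "\<And>F. F \<in> set Fs \<Longrightarrow> cring F \<and> vn_regular F"
  shows "vn_regular (RDirProd_list Fs)"
  using assms
proof (induction Fs)
  case Nil
  show ?case by (simp add: vn_regular_def monoid.defs)
next
  case (Cons F Fs)
  interpret F: cring F using Cons.prems by simp
  interpret S: cring "RDirProd_list Fs"
    using Cons.prems by (intro RDirProd_list_cring) simp
  show ?case unfolding vn_regular_def
  proof
    fix z assume "z \<in> carrier (RDirProd_list (F # Fs))"
    then obtain x xs where z: "z = x # xs" "x \<in> carrier F" "xs \<in> carrier (RDirProd_list Fs)"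
      by (auto simp: RDirProd_list_carrier)
    obtain y where y: "y \<in> carrier F" "x \<otimes>\<^bsub>F\<^esub> y \<otimes>\<^bsub>F\<^esub> x = x"
      using Cons.prems z(2) by (force simp: vn_regular_def)
    have "vn_regular (RDirProd_list Fs)" using Cons by simp
    then obtain ys where ys: "ys \<in> carrier (RDirProd_list Fs)"
      "xs \<otimes>\<^bsub>RDirProd_list Fs\<^esub> ys \<otimes>\<^bsub>RDirProd_list Fs\<^esub> xs = xs"
      using z(3) by (auto simp: vn_regular_def)
    show "\<exists>w\<in>carrier (RDirProd_list (F # Fs)).
        z \<otimes>\<^bsub>RDirProd_list (F # Fs)\<^esub> w \<otimes>\<^bsub>RDirProd_list (F # Fs)\<^esub> z = z"
      using z y ys
      by (intro bexI[of _ "y # ys"]) (auto simp: RDirProd_list_mult_Cons RDirProd_list_carrier)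
  qed
qed

lemma RDirProd_list_idempotent:
  assumes "cring F" "\<one>\<^bsub>F\<^esub> \<noteq> \<zero>\<^bsub>F\<^esub>"
    and "cring (RDirProd_list Fs)" "\<one>\<^bsub>RDirProd_list Fs\<^esub> \<noteq> \<zero>\<^bsub>RDirProd_list Fs\<^esub>"
  shows "\<exists>e\<in>carrier (RDirProd_list (F # Fs)). e \<otimes>\<^bsub>RDirProd_list (F # Fs)\<^esub> e = e \<and>
    e \<noteq> \<zero>\<^bsub>RDirProd_list (F # Fs)\<^esub> \<and> e \<noteq> \<one>\<^bsub>RDirProd_list (F # Fs)\<^esub>"
proof -
  interpret F: cring F by fact
  interpret S: cring "RDirProd_list Fs" by fact
  show ?thesis
    using assms(2,4)
    \<comment> \<open>This is the idempotent (1, 0, ..., 0): it is not zero because the first factor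
      is nonzero, and not the identity because the remaining product is nonzero.\<close>
    by (intro bexI[of _ "\<one>\<^bsub>F\<^esub> # \<zero>\<^bsub>RDirProd_list Fs\<^esub>"])
      (auto simp: RDirProd_list_mult_Cons RDirProd_list_zero' RDirProd_list_one_Cons
        RDirProd_list_carrier)
qed

section \<open>Transfer along ring isomorphisms\<close>

text \<open>The image theorems for isomorphisms speak of \<open>S\<close> with its zero replaced by
  the image of zero; this equation identifies that structure with \<open>S\<close> itself.\<close>

lemma ring_iso_zero:
  assumes "ring R" "ring S" "h \<in> ring_iso R S"
  shows "h \<zero>\<^bsub>R\<^esub> = \<zero>\<^bsub>S\<^esub>"
  using assms ring_hom_zero[of h R S] by (simp add: ring_iso_def)

lemma ring_iso_cring:
  assumes "cring R" "ring S" "h \<in> ring_iso R S"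
  shows "cring S"
  using cring.ring_iso_imp_img_cring[OF assms(1,3)] ring_iso_zero[OF cring.axioms(1)[OF assms(1)] assms(2,3)]
  by simp

lemma ring_iso_field:
  assumes "field R" "ring S" "h \<in> ring_iso R S"
  shows "field S"
  using field.ring_iso_imp_img_field[OF assms(1,3)]
    ring_iso_zero[OF cring.axioms(1)[OF fieldE(1)[OF assms(1)]] assms(2,3)]
  by simp

lemma ring_iso_vn_regular:
  assumes "ring R" "vn_regular R" "h \<in> ring_iso R S"
  shows "vn_regular S"
  unfolding vn_regular_def
proof
  interpret ring R by fact
  fix x assume "x \<in> carrier S"
  then obtain a where a: "a \<in> carrier R" "x = h a"
    using ring_iso_memE(5)[OF assms(3)] by (auto simp: bij_betw_def)
  then obtain b where b: "b \<in> carrier R" "a \<otimes>\<^bsub>R\<^esub> b \<otimes>\<^bsub>R\<^esub> a = a"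
    using assms(2) by (auto simp: vn_regular_def)
  then have "h a \<otimes>\<^bsub>S\<^esub> h b \<otimes>\<^bsub>S\<^esub> h a = h a"
    using a(1) ring_iso_memE(2)[OF assms(3)] by (metis m_closed)
  then show "\<exists>y\<in>carrier S. x \<otimes>\<^bsub>S\<^esub> y \<otimes>\<^bsub>S\<^esub> x = x"
    using a b ring_iso_memE(1)[OF assms(3)] by blast
qed

lemma ring_iso_idempotent:
  assumes "ring R" "ring S" "h \<in> ring_iso R S"
    and "\<exists>e\<in>carrier R. e \<otimes>\<^bsub>R\<^esub> e = e \<and> e \<noteq> \<zero>\<^bsub>R\<^esub> \<and> e \<noteq> \<one>\<^bsub>R\<^esub>"
  shows "\<exists>e\<in>carrier S. e \<otimes>\<^bsub>S\<^esub> e = e \<and> e \<noteq> \<zero>\<^bsub>S\<^esub> \<and> e \<noteq> \<one>\<^bsub>S\<^esub>"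
proof -
  interpret ring R by fact
  obtain e where e: "e \<in> carrier R" "e \<otimes>\<^bsub>R\<^esub> e = e" "e \<noteq> \<zero>\<^bsub>R\<^esub>" "e \<noteq> \<one>\<^bsub>R\<^esub>"
    using assms(4) by blast
  have inj: "inj_on h (carrier R)"
    using ring_iso_memE(5)[OF assms(3)] by (simp add: bij_betw_def)
  have "h e \<noteq> h \<zero>\<^bsub>R\<^esub>" "h e \<noteq> h \<one>\<^bsub>R\<^esub>"
    using inj_onD[OF inj] e by auto
  then show ?thesis
    using e ring_iso_memE(1,4)[OF assms(3)] ring_iso_memE(2)[OF assms(3), of e e]
      ring_iso_zero[OF assms(1-3)] by (intro bexI[of _ "h e"]) auto
qed

section \<open>Connectedness\<close>

lemma reg_graph_adj_iff:
  "(a, b) \<in> parcs (reg_graph R) \<longleftrightarrow>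
    a \<in> carrier R - {\<zero>\<^bsub>R\<^esub>} \<and> b \<in> carrier R - {\<zero>\<^bsub>R\<^esub>} \<and> a \<noteq> b \<and>
    (a \<otimes>\<^bsub>R\<^esub> b \<otimes>\<^bsub>R\<^esub> a = a \<or> b \<otimes>\<^bsub>R\<^esub> a \<otimes>\<^bsub>R\<^esub> b = b)"
  by (simp add: reg_graph_def)

text \<open>Replacing an inner inverse \<open>y\<close> of \<open>a\<close> by \<open>y a y\<close>
  makes the relation symmetric: both equations reduce to \<open>a y a = a\<close> after
  reassociation.\<close>

lemma (in cring) vn_regular_quasi_inverse:
  assumes "vn_regular R" "a \<in> carrier R"
  obtains b where "b \<in> carrier R" "a \<otimes> b \<otimes> a = a" "b \<otimes> a \<otimes> b = b"
proof -
  obtain y where y: "y \<in> carrier R" "a \<otimes> y \<otimes> a = a"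
    using assms by (auto simp: vn_regular_def)
  have "a \<otimes> (y \<otimes> a \<otimes> y) \<otimes> a = (a \<otimes> y \<otimes> a) \<otimes> y \<otimes> a"
    using y(1) assms(2) by (simp add: m_assoc)
  also have "\<dots> = a" using y by simp
  finally have 1: "a \<otimes> (y \<otimes> a \<otimes> y) \<otimes> a = a" .
  have "(y \<otimes> a \<otimes> y) \<otimes> a \<otimes> (y \<otimes> a \<otimes> y) = y \<otimes> ((a \<otimes> y \<otimes> a) \<otimes> y \<otimes> a) \<otimes> y"
    using y(1) assms(2) by (simp add: m_assoc)
  also have "\<dots> = y \<otimes> a \<otimes> y" using y by simp
  finally show ?thesis using that[OF _ 1] y(1) assms(2) by simp
qed

lemma (in cring) reg_graph_nonunit_reachable_one:
  assumes "vn_regular R" "a \<in> carrier R" "a \<noteq> \<zero>" "a \<notin> Units R"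
  shows "a \<rightarrow>\<^sup>*\<^bsub>with_proj (reg_graph R)\<^esub> \<one>"
proof -
  interpret G: pair_bidirected_digraph "reg_graph R" by (rule reg_graph_simple)
  obtain b where b: "b \<in> carrier R" "a \<otimes> b \<otimes> a = a" "b \<otimes> a \<otimes> b = b"
    using vn_regular_quasi_inverse assms(1,2) by metis
  define f where "f = a \<otimes> b"
  define g where "g = \<one> \<ominus> f"
  note a = assms(2)
  have f: "f \<in> carrier R" and g: "g \<in> carrier R"
    using a b by (simp_all add: f_def g_def)
  \<comment> \<open>If \<open>a b = 1\<close>, then \<open>a\<close> would be a unit.\<close>
  have f1: "f \<noteq> \<one>"
    using a b(1) assms(4) unit_factor[of a b] by (auto simp: f_def)
  have fa: "f \<otimes> a = a" and fb: "f \<otimes> b = b"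
    using a b by (simp_all add: f_def m_comm)
  have ff: "f \<otimes> f = f"
    using a b(1) fa by (simp add: f_def m_assoc[symmetric])
  have f0: "f \<noteq> \<zero>" using fa a assms(3) by auto
  have b0: "b \<noteq> \<zero>" using b(2) a assms(3) by auto
  have g0: "g \<noteq> \<zero>" using f1 f by (simp add: g_def)
  \<comment> \<open>\<open>f\<close> and \<open>g\<close> are complementary idempotents: whatever
    \<open>f\<close> fixes, \<open>g\<close> kills. This applies to \<open>a\<close>,
    \<open>b\<close> and \<open>f\<close>.\<close>
  have ann: "g \<otimes> x = \<zero>" if "x \<in> carrier R" "f \<otimes> x = x" for x
    using that f by (simp add: g_def minus_eq l_distr l_minus r_neg)
  have ga: "g \<otimes> a = \<zero>" and gb: "g \<otimes> b = \<zero>" and gf: "g \<otimes> f = \<zero>"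
    using ann fa fb ff a b f by auto
  have "g \<otimes> g = g \<otimes> \<one> \<ominus> g \<otimes> f"
    unfolding g_def using f by algebra
  then have gg: "g \<otimes> g = g" using g gf by (simp add: minus_eq)
  have g1: "g \<noteq> \<one>"
    using gf f f0 by auto
  have ag: "a \<otimes> g = \<zero>" "f \<otimes> g = \<zero>"
    using ga gf g a f by (simp_all add: m_comm)
  \<comment> \<open>On the \<open>f\<close>-part \<open>?u\<close> is the inverse \<open>b\<close>
    of \<open>a\<close>, on the \<open>g\<close>-part it is the identity. Hence it is an inner
    inverse of both \<open>a\<close> and \<open>g\<close> and links these two orthogonal
    elements.\<close>
  let ?u = "b \<oplus> g"
  have u: "?u \<in> carrier R" using b g by simp
  have aua: "a \<otimes> ?u \<otimes> a = a"
    using a b g ag by (simp add: r_distr)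
  have gug: "g \<otimes> ?u \<otimes> g = g"
    using b g gb gg by (simp add: r_distr)
  have gu: "g \<otimes> ?u = g"
    using b g gb gg by (simp add: r_distr)
  have fu: "f \<otimes> ?u = b"
    using b g f fb ag by (simp add: r_distr)
  have "?u \<noteq> \<zero>" using gu g g0 by auto
  \<comment> \<open>Multiplication by \<open>g\<close> separates them: \<open>g ?u = g\<close> is
    nonzero, while \<open>g a\<close> is zero.\<close>
  moreover have "?u \<noteq> a" using gu ga g0 by auto
  ultimately have "a \<rightarrow>\<^bsub>with_proj (reg_graph R)\<^esub> ?u"
    using a u assms(3) aua by (auto simp: reg_graph_adj_iff)
  \<comment> \<open>Here multiplication by \<open>f\<close> separates: \<open>f ?u = b\<close> is
    nonzero, while \<open>f g\<close> is zero.\<close>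
  also have "?u \<noteq> g" using fu ag b0 by auto
  then have "?u \<rightarrow>\<^bsub>with_proj (reg_graph R)\<^esub> g"
    using u g g0 gug \<open>?u \<noteq> \<zero>\<close> by (auto simp: reg_graph_adj_iff)
  also have "\<one> \<noteq> \<zero>" using g g0 one_zeroD by auto
  then have "g \<rightarrow>\<^bsub>with_proj (reg_graph R)\<^esub> \<one>"
    using g g0 g1 gg by (auto simp: reg_graph_adj_iff)
  finally show ?thesis by auto
qed

lemma (in cring) reg_graph_reachable_one:
  assumes "vn_regular R"
    and e: "e \<in> carrier R" "e \<otimes> e = e" "e \<noteq> \<zero>" "e \<noteq> \<one>"
    and a: "a \<in> carrier R" "a \<noteq> \<zero>"
  shows "a \<rightarrow>\<^sup>*\<^bsub>with_proj (reg_graph R)\<^esub> \<one>"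
proof (cases "a \<in> Units R")
  case False
  then show ?thesis using reg_graph_nonunit_reachable_one assms by simp
next
  case True
  interpret G: pair_bidirected_digraph "reg_graph R" by (rule reg_graph_simple)
  \<comment> \<open>\<open>c\<close> is a multiple of the proper idempotent \<open>e\<close>, hence
    not a unit, and \<open>c a c = c e = c\<close> makes it a neighbour of \<open>a\<close>.\<close>
  define c where "c = inv a \<otimes> e"
  have c: "c \<in> carrier R" using True e by (simp add: c_def)
  have ac: "a \<otimes> c = e"
    using True a e by (simp add: c_def m_assoc[symmetric])
  have c0: "c \<noteq> \<zero>" using ac a e by auto
  have cac: "c \<otimes> a \<otimes> c = c"
    using True a c e ac by (simp add: m_assoc) (simp add: c_def m_assoc)
  have nu: "c \<notin> Units R"
  proof
    assume "c \<in> Units R"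
    then have "e \<in> Units R" using ac True by (metis Units_m_closed)
    \<comment> \<open>A unit that is idempotent can be cancelled from
      \<open>e e = e 1\<close>.\<close>
    then have "e = \<one>" using e(1,2) by (metis Units_l_cancel r_one one_closed)
    with e show False by simp
  qed
  then have "a \<noteq> c" using True by auto
  then have "a \<rightarrow>\<^bsub>with_proj (reg_graph R)\<^esub> c"
    using a c c0 cac by (auto simp: reg_graph_adj_iff)
  moreover have "c \<rightarrow>\<^sup>*\<^bsub>with_proj (reg_graph R)\<^esub> \<one>"
    using reg_graph_nonunit_reachable_one assms(1) c c0 nu by simp
  ultimately show ?thesis by (auto intro: G.adj_reachable_trans)
qed

lemma reg_graph_connected:
  assumes "cring R" "vn_regular R"
    and e: "e \<in> carrier R" "e \<otimes>\<^bsub>R\<^esub> e = e" "e \<noteq> \<zero>\<^bsub>R\<^esub>" "e \<noteq> \<one>\<^bsub>R\<^esub>"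
  shows "Digraph_Component.connected (reg_graph R)"
proof -
  interpret cring R by fact
  interpret G: pair_bidirected_digraph "reg_graph R" by (rule reg_graph_simple)
  have sym: "symmetric (with_proj (reg_graph R))"
    by (rule G.sym_arcs)
  have one: "u \<rightarrow>\<^sup>*\<^bsub>with_proj (reg_graph R)\<^esub> \<one>\<^bsub>R\<^esub>" if "u \<in> carrier R - {\<zero>\<^bsub>R\<^esub>}" for u
    using that reg_graph_reachable_one assms by simp
  \<comment> \<open>\<open>connected\<close> means strong connectedness of the symmetric closure.
    The path from \<open>u\<close> to the identity is followed by the reversed path from
    \<open>v\<close>, then lifted to that closure.\<close>
  have "u \<rightarrow>\<^sup>*\<^bsub>with_proj (mk_symmetric (with_proj (reg_graph R)))\<^esub> v"
    if "u \<in> carrier R - {\<zero>\<^bsub>R\<^esub>}" "v \<in> carrier R - {\<zero>\<^bsub>R\<^esub>}" for u v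
    using G.reachable_mk_symmetricI G.reachable_trans one[OF that(1)]
      symmetric_reachable[OF sym one[OF that(2)]] by blast
  moreover have "verts (with_proj (reg_graph R)) = carrier R - {\<zero>\<^bsub>R\<^esub>}"
    by (simp add: reg_graph_def)
  ultimately show ?thesis
    using e unfolding Digraph_Component.connected_def strongly_connected_def by auto
qed

lemma reg_graph_nontrivial:
  assumes "ring R" and e: "e \<in> carrier R" "e \<noteq> \<zero>\<^bsub>R\<^esub>" "e \<noteq> \<one>\<^bsub>R\<^esub>"
  shows "nontrivial_graph (reg_graph R)"
proof -
  interpret ring R by fact
  \<comment> \<open>The two vertices are \<open>e\<close> and the identity; in the zero ring
    \<open>e\<close> would be zero.\<close>
  have "\<one>\<^bsub>R\<^esub> \<noteq> \<zero>\<^bsub>R\<^esub>" using e one_zeroD by auto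
  then show ?thesis using e by (auto simp: nontrivial_graph_def reg_graph_def)
qed

section \<open>The case of a single field\<close>

lemma (in field) reg_graph_one_isolated:
  "\<not> \<one> \<rightarrow>\<^bsub>with_proj (reg_graph R)\<^esub> w"
proof
  assume "\<one> \<rightarrow>\<^bsub>with_proj (reg_graph R)\<^esub> w"
  \<comment> \<open>With one of the vertices equal to the identity, the two adjacency conditions
    become \<open>w = 1\<close> and \<open>w w = w\<close>; in a field the latter forces
    \<open>w\<close> to be zero or one.\<close>
  then have w: "w \<in> carrier R" "w \<noteq> \<zero>" "w \<noteq> \<one>" "w = \<one> \<or> w \<otimes> w = w"
    by (auto simp: reg_graph_adj_iff)
  then have "w \<otimes> w = w \<otimes> \<one>" by auto
  then show False using w m_lcancel[of w w \<one>] by simp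
qed

lemma (in field) reg_graph_field_not_connected:
  assumes "nontrivial_graph (reg_graph R)"
  shows "\<not> Digraph_Component.connected (reg_graph R)"
proof
  interpret G: pair_bidirected_digraph "reg_graph R" by (rule reg_graph_simple)
  assume conn: "Digraph_Component.connected (reg_graph R)"
  \<comment> \<open>Of two distinct vertices, at least one differs from the identity.\<close>
  obtain v where v: "v \<in> carrier R" "v \<noteq> \<zero>" "v \<noteq> \<one>"
    using assms by (auto simp: nontrivial_graph_def reg_graph_def) 
  then have "\<one> \<rightarrow>\<^sup>*\<^bsub>with_proj (mk_symmetric (with_proj (reg_graph R)))\<^esub> v"
    using conn by (auto simp: Digraph_Component.connected_def strongly_connected_def reg_graph_def)
  then have "\<one> \<rightarrow>\<^sup>*\<^bsub>with_proj (reg_graph R)\<^esub> v"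
    using G.reachable_mk_symmetric_eq[OF G.sym_arcs] by simp
  \<comment> \<open>A path from the identity to a different vertex would need a first arc leaving
    the identity.\<close>
  then show False
    using v(3) reg_graph_one_isolated by (auto elim: G.converse_reachable_cases)
qed

section \<open>The equivalence for products of fields\<close>

theorem theorem5:
  fixes R :: "('a, 'm) ring_scheme"
    and Fs :: "('b, 'k) ring_scheme list"
    and n :: nat
  assumes "n \<ge> 1"
    and "ring R"
    and "length Fs = n"
    and "\<And>i. i < n \<Longrightarrow> field (Fs ! i)"
    and "\<And>i. i < n \<Longrightarrow> finite (carrier (Fs ! i))"
    and "R \<simeq> RDirProd_list Fs"
  shows "nontrivial_graph (reg_graph R) \<and> Digraph_Component.connected (reg_graph R) \<longleftrightarrow> n \<ge> 2"
proof
  have field: "field F" if "F \<in> set Fs" for F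
    using that assms(3,4) by (auto simp: in_set_conv_nth)
  then have cring: "cring F" if "F \<in> set Fs" for F
    using that fieldE(1) by blast
  interpret P: cring "RDirProd_list Fs" using cring by (rule RDirProd_list_cring)
  \<comment> \<open>The isomorphism is inverted so that properties of the product can be carried
    over to \<open>R\<close>.\<close>
  obtain h where h: "h \<in> ring_iso (RDirProd_list Fs) R"
    using assms(6) ring_iso_set_sym[OF assms(2)] by (auto simp: is_ring_iso_def)
  {
    assume n: "n \<ge> 2"
    \<comment> \<open>The second field \<open>F'\<close> ensures that the product of the factors
      after \<open>F\<close> is not the zero ring, as the idempotent requires.\<close>
    then obtain F F' Fs' where Fs: "Fs = F # F' # Fs'"
      using assms(3) by (metis Suc_le_length_iff numeral_2_eq_2)
    interpret F: field F using field Fs by simp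
    interpret F': field F' using field Fs by simp
    have "\<exists>e\<in>carrier (RDirProd_list Fs). e \<otimes>\<^bsub>RDirProd_list Fs\<^esub> e = e \<and>
        e \<noteq> \<zero>\<^bsub>RDirProd_list Fs\<^esub> \<and> e \<noteq> \<one>\<^bsub>RDirProd_list Fs\<^esub>"
      unfolding Fs
      by (intro RDirProd_list_idempotent RDirProd_list_cring F.is_cring)
        (use cring Fs in \<open>auto simp: RDirProd_list_one_Cons RDirProd_list_zero'\<close>)
    then obtain e where e: "e \<in> carrier R" "e \<otimes>\<^bsub>R\<^esub> e = e" "e \<noteq> \<zero>\<^bsub>R\<^esub>" "e \<noteq> \<one>\<^bsub>R\<^esub>"
      using ring_iso_idempotent[OF P.ring_axioms assms(2) h] by blast
    have "vn_regular R"
      using RDirProd_list_vn_regular[of Fs] cring field field.field_vn_regular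
        ring_iso_vn_regular[OF P.ring_axioms _ h] by blast
    then show "nontrivial_graph (reg_graph R) \<and> Digraph_Component.connected (reg_graph R)"
      using reg_graph_connected[OF ring_iso_cring[OF P.cring_axioms assms(2) h] _ e]
        reg_graph_nontrivial[OF assms(2) e(1,3,4)] by blast
  }
  assume G: "nontrivial_graph (reg_graph R) \<and> Digraph_Component.connected (reg_graph R)"
  show "n \<ge> 2"
  proof (rule ccontr)
    assume "\<not> n \<ge> 2"
    with assms(1,3) have "length Fs = Suc 0" by simp
    then obtain F where Fs: "Fs = [F]" by (auto simp: length_Suc_conv)
    \<comment> \<open>A product with one factor is that factor via \<open>a\<close> to
      \<open>[a]\<close>, so \<open>R\<close> is itself a field.\<close>
    have "h \<circ> (\<lambda>a. [a]) \<in> ring_iso F R"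
      using ring_iso_set_trans[OF RDirProd_list_iso3 h[unfolded Fs]] .
    then have "field R"
      using ring_iso_field field Fs assms(2) by fastforce
    then show False using G field.reg_graph_field_not_connected by blast
  qed
qed

end
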